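(* Let $I$ and $Q$ be compact topological spaces and let $R: I\times Q\to\mathbb{R}$ be a continuous function. Let $f_I$ and $f_Q$ be neural architectures with the universal-approximation property (e.g., multilayer perceptrons), as defined in the context. Then $R$ can be uniformly approximated up to an arbitrarily small absolute error by inner products of relevance-based embeddings: for every $\varepsilon>0$ there exist finite sets $S_I=\{i_1,\ldots,i_m\}\subset I$ of support items and $S_Q=\{q_1,\ldots,q_n\}\subset Q$ of support queries, a dimension $d\ge 1$, and parameters $\theta_I$ (for $f_I$ as an architecture of maps $\mathbb{R}^n\to\mathbb{R}^d$) and $\theta_Q$ (for $f_Q$ as an architecture of maps $\mathbb{R}^m\to\mathbb{R}^d$) such that the function $$\tilde R(i,q)=\big\langle\, f_I(R(i,S_Q),\theta_I),\; f_Q(R(S_I,q),\theta_Q)\,\big\rangle$$ satisfies $|R(i,q)-\tilde R(i,q)|<\varepsilon$ for all $i\in I$ and $q\in Q$.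
   Context: For finite ordered sets $S_I=\{i_1,\ldots,i_m\}\subset I$ and $S_Q=\{q_1,\ldots,q_n\}\subset Q$, the relevance vectors are $R(i,S_Q)=(R(i,q_1),\ldots,R(i,q_n))\in\mathbb{R}^n$ for $i\in I$, and $R(S_I,q)=(R(i_1,q),\ldots,R(i_m,q))\in\mathbb{R}^m$ for $q\in Q$. $\langle\cdot,\cdot\rangle$ is the standard dot product on $\mathbb{R}^d$. A neural architecture $f$ is, for each input dimension $n$ and output dimension $d$, a family of maps $f(\cdot,\theta):\mathbb{R}^n\to\mathbb{R}^d$ indexed by parameters $\theta$ (the size of the network is considered part of the parameters). It has the universal-approximation property if for all $n,d$, every compact $K\subset\mathbb{R}^n$, every continuous $g:K\to\mathbb{R}^d$ and every $\delta>0$, there is a parameter $\theta$ with $\sup_{x\in K}\|f(x,\theta)-g(x)\|<\delta$. A relevance-based embedding of items is a map $I\to\mathbb{R}^d$ of the form $i\mapsto f_I(R(i,S_Q),\theta_I)$; a relevance-based embedding of queries is a map $Q\to\mathbb{R}^d$ of the form $q\mapsto f_Q(R(S_I,q),\theta_Q)$. *)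

theory Defs
  imports "HOL-Analysis.Analysis"
begin

text \<open>Dimensions are quantified inside the statement, so a vector of $R^n$ is a sequence
  vanishing from index \<open>n\<close> on, i.e. a point of \<^const>\<open>Euclidean_space\<close> \<open>n\<close>; coordinates are
  numbered from 0.\<close>

type_synonym vec = "nat \<Rightarrow> real"

definition dot :: "nat \<Rightarrow> vec \<Rightarrow> vec \<Rightarrow> real" where
  "dot d x y = (\<Sum>k<d. x k * y k)"

text \<open>\<open>\<Theta> n d\<close> is the set of admissible parameters for maps from $R^n$ to $R^d$. It may depend on
  the dimensions, and one parameter type covers networks of all sizes. Nonemptiness only adds
  something to the approximation property below when a dimension is 0.\<close>

definition neural_architecture ::
  "(nat \<Rightarrow> nat \<Rightarrow> 'p set) \<Rightarrow> (nat \<Rightarrow> nat \<Rightarrow> vec \<Rightarrow> 'p \<Rightarrow> vec) \<Rightarrow> bool" where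
  "neural_architecture \<Theta> f \<longleftrightarrow>
     (\<forall>n d. \<Theta> n d \<noteq> {} \<and>
        (\<forall>\<theta>\<in>\<Theta> n d. \<forall>x\<in>topspace (Euclidean_space n). f n d x \<theta> \<in> topspace (Euclidean_space d)))"

text \<open>The supremum is taken in \<^typ>\<open>ereal\<close>, since the maps \<open>f n d _ \<theta>\<close> need not be bounded
  on \<open>K\<close> and \<open>K\<close> may be empty.\<close>

definition universal_approximation ::
  "(nat \<Rightarrow> nat \<Rightarrow> 'p set) \<Rightarrow> (nat \<Rightarrow> nat \<Rightarrow> vec \<Rightarrow> 'p \<Rightarrow> vec) \<Rightarrow> bool" where
  "universal_approximation \<Theta> f \<longleftrightarrow>
     (\<forall>n\<ge>1. \<forall>d\<ge>1. \<forall>K g. \<forall>\<delta>>0.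
        compactin (Euclidean_space n) K \<longrightarrow>
        continuous_map (subtopology (Euclidean_space n) K) (Euclidean_space d) g \<longrightarrow>
        (\<exists>\<theta>\<in>\<Theta> n d. (SUP x\<in>K. ereal (L2_set (\<lambda>k. f n d x \<theta> k - g x k) {..<d})) < ereal \<delta>))"

text \<open>Finite ordered support sets are distinct lists.\<close>

definition item_relevance :: "('a \<Rightarrow> 'b \<Rightarrow> real) \<Rightarrow> 'b list \<Rightarrow> 'a \<Rightarrow> vec" where
  "item_relevance R SQ i = (\<lambda>k. if k < length SQ then R i (SQ ! k) else 0)"

definition query_relevance :: "('a \<Rightarrow> 'b \<Rightarrow> real) \<Rightarrow> 'a list \<Rightarrow> 'b \<Rightarrow> vec" where
  "query_relevance R SI q = (\<lambda>k. if k < length SI then R (SI ! k) q else 0)"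

definition item_embedding ::
  "('a \<Rightarrow> 'b \<Rightarrow> real) \<Rightarrow> (nat \<Rightarrow> nat \<Rightarrow> vec \<Rightarrow> 'p \<Rightarrow> vec) \<Rightarrow> nat \<Rightarrow> 'b list \<Rightarrow> 'p \<Rightarrow> 'a \<Rightarrow> vec" where
  "item_embedding R f d SQ \<theta> i = f (length SQ) d (item_relevance R SQ i) \<theta>"

definition query_embedding ::
  "('a \<Rightarrow> 'b \<Rightarrow> real) \<Rightarrow> (nat \<Rightarrow> nat \<Rightarrow> vec \<Rightarrow> 'p \<Rightarrow> vec) \<Rightarrow> nat \<Rightarrow> 'a list \<Rightarrow> 'p \<Rightarrow> 'b \<Rightarrow> vec" where
  "query_embedding R f d SI \<theta> q = f (length SI) d (query_relevance R SI q) \<theta>"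

end

theory Submission
  imports Defs
begin

text \<open>By the tube lemma and compactness there are finite sets of items and of queries such that every
  item (query) has, up to \<open>\<eta>\<close> and uniformly in the other argument, the same relevance as one of
  these representatives; take them as support sets. If the vectors \<open>R(S\<^sub>I, q)\<close> and
  \<open>R(S\<^sub>I, q\<^sub>k)\<close> are close, then \<open>R(i, q)\<close> and \<open>R(i, q\<^sub>k)\<close> are close for all \<open>i\<close>, so
  \<open>R(i, q)\<close> is approximately \<open>\<Sum>\<^sub>k \<phi>\<^sub>k(q) R(i, q\<^sub>k)\<close> for a partition of unity \<open>\<phi>\<close> that is a
  continuous function of \<open>R(S\<^sub>I, q)\<close>. This is already an inner product: let \<open>f\<^sub>I\<close> approximate the
  identity and \<open>f\<^sub>Q\<close> the map \<open>R(S\<^sub>I, q) \<mapsto> \<phi>(q)\<close>.\<close>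

text \<open>A coordinate of the error is at most its Euclidean norm, hence below the supremum.
  Coordinatewise bounds are the form that the dot product estimate consumes.\<close>

lemma universal_approximation_pointwise:
  assumes "universal_approximation \<Theta> f" "n \<ge> 1" "d \<ge> 1" "\<delta> > 0"
    and "compactin (Euclidean_space n) K"
    and "continuous_map (subtopology (Euclidean_space n) K) (Euclidean_space d) g"
  obtains \<theta> where "\<theta> \<in> \<Theta> n d" "\<And>x k. x \<in> K \<Longrightarrow> k < d \<Longrightarrow> \<bar>f n d x \<theta> k - g x k\<bar> < \<delta>"
proof -
  obtain \<theta> where \<theta>: "\<theta> \<in> \<Theta> n d"
    and sup: "(SUP x\<in>K. ereal (L2_set (\<lambda>k. f n d x \<theta> k - g x k) {..<d})) < ereal \<delta>"
    using assms unfolding universal_approximation_def by blast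
  show thesis
  proof
    fix x k assume "x \<in> K" "k < d"
    have "ereal (L2_set (\<lambda>k. f n d x \<theta> k - g x k) {..<d}) < ereal \<delta>"
      using SUP_upper[OF \<open>x \<in> K\<close>] sup by (rule le_less_trans)
    moreover have "\<bar>f n d x \<theta> k - g x k\<bar> \<le> L2_set (\<lambda>k. \<bar>f n d x \<theta> k - g x k\<bar>) {..<d}"
      using \<open>k < d\<close> by (intro member_le_L2_set) auto
    moreover have "\<dots> = L2_set (\<lambda>k. f n d x \<theta> k - g x k) {..<d}"
      by (simp add: L2_set_def)
    ultimately show "\<bar>f n d x \<theta> k - g x k\<bar> < \<delta>" by simp
  qed (fact \<theta>)
qed

text \<open>For fixed \<open>b\<close> the set \<open>W\<close> is open and contains the slice over
  \<open>b\<close>, so the tube lemma gives a neighbourhood of \<open>b\<close> that serves all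
  \<open>x\<close> at once; finitely many of these cover \<open>Y\<close>. With no metric on the
  spaces, this takes the place of uniform continuity.\<close>

lemma finite_uniform_net:
  fixes R :: "'a \<Rightarrow> 'b \<Rightarrow> real"
  assumes X: "compact_space X" and Y: "compact_space Y"
    and R: "continuous_map (prod_topology X Y) euclideanreal (\<lambda>(x, y). R x y)" and "\<epsilon> > 0"
  obtains ys where "distinct ys" "set ys \<subseteq> topspace Y"
    "\<And>y. y \<in> topspace Y \<Longrightarrow> \<exists>y'\<in>set ys. \<forall>x\<in>topspace X. \<bar>R x y - R x y'\<bar> < \<epsilon>"
proof -
  have "\<exists>V. openin Y V \<and> b \<in> V \<and> (\<forall>x\<in>topspace X. \<forall>y\<in>V. \<bar>R x y - R x b\<bar> < \<epsilon>)"
    if b: "b \<in> topspace Y" for b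
  proof -
    define W where "W = {p \<in> topspace (prod_topology X Y).
      \<bar>(case p of (x, y) \<Rightarrow> R x y) - R (fst p) b\<bar> \<in> {..<\<epsilon>}}"
    have "continuous_map (prod_topology X Y) (prod_topology X Y) (\<lambda>p. (fst p, b))"
      using b by (intro continuous_map_pairedI continuous_map_fst) auto
    from continuous_map_compose[OF this R]
    have "continuous_map (prod_topology X Y) euclideanreal (\<lambda>p. R (fst p) b)"
      by (simp add: o_def)
    then have "openin (prod_topology X Y) W"
      unfolding W_def
      by (intro openin_continuous_map_preimage[where Y = euclideanreal] continuous_map_real_abs
          continuous_map_diff R) auto
    moreover have "topspace X \<times> {b} \<subseteq> W"
      using b \<open>\<epsilon> > 0\<close> by (auto simp: W_def)
    moreover have "compactin X (topspace X)"
      using X by (simp add: compact_space_def)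
    ultimately obtain U V where "openin Y V" "topspace X \<subseteq> U" "b \<in> V" "U \<times> V \<subseteq> W"
      using tube_lemma_left b by metis
    then show ?thesis
      by (intro exI[of _ V]) (fastforce simp: W_def)
  qed
  then obtain V where V: "\<And>b. b \<in> topspace Y \<Longrightarrow>
      openin Y (V b) \<and> b \<in> V b \<and> (\<forall>x\<in>topspace X. \<forall>y\<in>V b. \<bar>R x y - R x b\<bar> < \<epsilon>)"
    by metis
  have "\<exists>\<F>. finite \<F> \<and> \<F> \<subseteq> V ` topspace Y \<and> topspace Y \<subseteq> \<Union>\<F>"
    using V by (intro Y[unfolded compact_space_alt, rule_format]) blast
  then obtain F where "finite F" "F \<subseteq> topspace Y" "topspace Y \<subseteq> \<Union>(V ` F)"
    by (metis finite_subset_image)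
  moreover obtain ys where "set ys = F" "distinct ys"
    using finite_distinct_list[OF \<open>finite F\<close>] by blast
  ultimately show thesis
    using V by (intro that[of ys]) (blast, blast, metis UN_E subset_iff)
qed

text \<open>Allows facts about one argument of \<open>R\<close> to be reused with items and queries
  exchanged.\<close>

lemma continuous_map_prod_topology_swap:
  assumes "continuous_map (prod_topology X Y) Z (\<lambda>(x, y). f x y)"
  shows "continuous_map (prod_topology Y X) Z (\<lambda>(y, x). f x y)"
proof -
  have "continuous_map (prod_topology Y X) (prod_topology X Y) (\<lambda>p. (snd p, fst p))"
    by (intro continuous_map_pairedI continuous_map_fst continuous_map_snd)
  from continuous_map_compose[OF this assms] show ?thesis
    by (simp add: o_def case_prod_unfold)
qed

lemma query_relevance_eq: "query_relevance R = item_relevance (\<lambda>q i. R i q)"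
  by (simp add: fun_eq_iff query_relevance_def item_relevance_def)

text \<open>Each coordinate is a continuous section of \<open>R\<close>, so this is a continuous
  image of a compact space. Universal approximation is available only on such compact
  domains.\<close>

lemma compactin_item_relevance:
  assumes "compact_space I"
    and R: "continuous_map (prod_topology I Q) euclideanreal (\<lambda>(i, q). R i q)"
    and "set SQ \<subseteq> topspace Q"
  shows "compactin (Euclidean_space (length SQ)) (item_relevance R SQ ` topspace I)"
proof -
  have "continuous_map I euclideanreal (\<lambda>i. R i (SQ ! k))" if "k < length SQ" for k
  proof -
    have "continuous_map I (prod_topology I Q) (\<lambda>i. (i, SQ ! k))"
      using subsetD[OF assms(3) nth_mem[OF that]]
      by (intro continuous_map_pairedI continuous_map_id[unfolded id_def]) auto
    from continuous_map_compose[OF this R] show ?thesis by (simp add: o_def)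
  qed
  then have "continuous_map I (Euclidean_space (length SQ)) (item_relevance R SQ)"
    unfolding item_relevance_def by (simp add: continuous_map_componentwise_Euclidean_space)
  then show ?thesis
    using assms(1) by (intro image_compactin) (auto simp: compact_space_def)
qed

text \<open>Since \<open>x\<close> is its own weighted average, the difference is the average of the
  \<open>x - r k\<close>, and terms of weight zero drop out.\<close>

lemma abs_weighted_average_diff_le:
  fixes w r :: "'k \<Rightarrow> real"
  assumes "\<And>k. k \<in> A \<Longrightarrow> w k \<ge> 0" "sum w A > 0"
    and "\<And>k. k \<in> A \<Longrightarrow> w k \<noteq> 0 \<Longrightarrow> \<bar>x - r k\<bar> \<le> e"
  shows "\<bar>x - (\<Sum>k\<in>A. r k * (w k / sum w A))\<bar> \<le> e"
proof -
  have "x - (\<Sum>k\<in>A. r k * (w k / sum w A)) = (\<Sum>k\<in>A. (x - r k) * w k) / sum w A"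
    using assms(2)
    by (simp add: left_diff_distrib sum_subtractf diff_divide_distrib
        flip: sum_distrib_left sum_divide_distrib)
  moreover have "\<bar>\<Sum>k\<in>A. (x - r k) * w k\<bar> \<le> (\<Sum>k\<in>A. e * w k)"
    using assms(1,3) by (intro order_trans[OF sum_abs] sum_mono)
      (metis abs_mult abs_of_nonneg mult_right_mono mult_zero_right abs_zero order_refl)
  ultimately show ?thesis
    using assms(2) by (simp add: abs_divide divide_le_eq flip: sum_distrib_left)
qed

text \<open>Changing one factor at a time costs \<delta> for \<open>x\<close> and
  \<open>(M + 1) * \<delta>\<close> for \<open>y\<close> per coordinate, because \<delta> \<le> 1
  gives \<open>\<bar>x' k\<bar> \<le> M + 1\<close>.\<close>

lemma dot_perturb:
  assumes "\<delta> \<le> 1" "M \<ge> 0"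
    and "\<And>k. k < d \<Longrightarrow> \<bar>x k\<bar> \<le> M" "\<And>k. k < d \<Longrightarrow> \<bar>y k\<bar> \<le> 1"
    and "\<And>k. k < d \<Longrightarrow> \<bar>x' k - x k\<bar> < \<delta>" "\<And>k. k < d \<Longrightarrow> \<bar>y' k - y k\<bar> < \<delta>"
  shows "\<bar>dot d x y - dot d x' y'\<bar> \<le> real d * ((M + 2) * \<delta>)"
proof -
  have "\<bar>x k * y k - x' k * y' k\<bar> \<le> (M + 2) * \<delta>" if "k < d" for k
  proof -
    have "x k * y k - x' k * y' k = - ((x' k - x k) * y k) - x' k * (y' k - y k)"
      by algebra
    then have "\<bar>x k * y k - x' k * y' k\<bar> \<le> \<bar>x' k - x k\<bar> * \<bar>y k\<bar> + \<bar>x' k\<bar> * \<bar>y' k - y k\<bar>"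
      unfolding abs_mult[symmetric] by linarith
    also have "\<dots> \<le> \<delta> * 1 + (M + 1) * \<delta>"
      using assms(1,2) assms(3-6)[OF that] by (intro add_mono mult_mono) auto
    finally show ?thesis by (simp add: algebra_simps)
  qed
  then have "(\<Sum>k<d. \<bar>x k * y k - x' k * y' k\<bar>) \<le> (\<Sum>k<d. (M + 2) * \<delta>)"
    by (intro sum_mono) auto
  then show ?thesis
    unfolding dot_def sum_subtractf[symmetric] by (intro order_trans[OF sum_abs]) simp
qed

theorem theorem3p2:
  fixes I :: "'a topology" and Q :: "'b topology"
    and R :: "'a \<Rightarrow> 'b \<Rightarrow> real"
    and f\<^sub>I :: "nat \<Rightarrow> nat \<Rightarrow> vec \<Rightarrow> 'p \<Rightarrow> vec" and \<Theta>\<^sub>I :: "nat \<Rightarrow> nat \<Rightarrow> 'p set"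
    and f\<^sub>Q :: "nat \<Rightarrow> nat \<Rightarrow> vec \<Rightarrow> 'r \<Rightarrow> vec" and \<Theta>\<^sub>Q :: "nat \<Rightarrow> nat \<Rightarrow> 'r set"
    and \<epsilon> :: real
  assumes "compact_space I" and "compact_space Q"
    and "continuous_map (prod_topology I Q) euclideanreal (\<lambda>(i, q). R i q)"
    and "neural_architecture \<Theta>\<^sub>I f\<^sub>I" and "universal_approximation \<Theta>\<^sub>I f\<^sub>I"
    and "neural_architecture \<Theta>\<^sub>Q f\<^sub>Q" and "universal_approximation \<Theta>\<^sub>Q f\<^sub>Q"
    and "\<epsilon> > 0"
  shows "\<exists>SI SQ d \<theta>\<^sub>I \<theta>\<^sub>Q.
           distinct SI \<and> set SI \<subseteq> topspace I \<and>
           distinct SQ \<and> set SQ \<subseteq> topspace Q \<and>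
           d \<ge> 1 \<and> \<theta>\<^sub>I \<in> \<Theta>\<^sub>I (length SQ) d \<and> \<theta>\<^sub>Q \<in> \<Theta>\<^sub>Q (length SI) d \<and>
           (\<forall>i\<in>topspace I. \<forall>q\<in>topspace Q.
              \<bar>R i q - dot d (item_embedding R f\<^sub>I d SQ \<theta>\<^sub>I i)
                             (query_embedding R f\<^sub>Q d SI \<theta>\<^sub>Q q)\<bar> < \<epsilon>)"
proof (cases "topspace I = {} \<or> topspace Q = {}")
  case True
  \<comment> \<open>The error bound is vacuous here. Empty support lists have input dimension 0,
    which universal approximation does not cover, so the parameters come from nonemptiness of the
    parameter sets.\<close>
  obtain \<theta>\<^sub>I \<theta>\<^sub>Q where "\<theta>\<^sub>I \<in> \<Theta>\<^sub>I 0 1" "\<theta>\<^sub>Q \<in> \<Theta>\<^sub>Q 0 1"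
    using assms(4,6) unfolding neural_architecture_def by blast
  with True show ?thesis
    by (intro exI[of _ "[]"] exI[of _ 1] exI[of _ \<theta>\<^sub>I] exI[of _ \<theta>\<^sub>Q]) auto
next
  case False
  \<comment> \<open>Averaging will cost at most 5\<eta> = \<epsilon>/2 and the two networks at most
    \<epsilon>/4, which leaves a strict margin below \<epsilon>.\<close>
  define \<eta> where "\<eta> = \<epsilon> / 10"
  have "\<eta> > 0" using \<open>\<epsilon> > 0\<close> by (simp add: \<eta>_def)
  note swap = continuous_map_prod_topology_swap[OF assms(3)]
  obtain SQ where SQ: "distinct SQ" "set SQ \<subseteq> topspace Q"
    and netQ: "\<And>q. q \<in> topspace Q \<Longrightarrow> \<exists>q'\<in>set SQ. \<forall>i\<in>topspace I. \<bar>R i q - R i q'\<bar> < \<eta>"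
    using finite_uniform_net[OF assms(1-3) \<open>\<eta> > 0\<close>] by blast
  obtain SI where SI: "distinct SI" "set SI \<subseteq> topspace I"
    and netI: "\<And>i. i \<in> topspace I \<Longrightarrow> \<exists>i'\<in>set SI. \<forall>q\<in>topspace Q. \<bar>R i q - R i' q\<bar> < \<eta>"
    using finite_uniform_net[OF assms(2,1) swap \<open>\<eta> > 0\<close>] by blast
  define m n where "m = length SI" and "n = length SQ"
  have "SQ \<noteq> []" "SI \<noteq> []"
    using False netI netQ by fastforce+
  then have "m \<ge> 1" "n \<ge> 1"
    by (simp_all add: m_def n_def Suc_le_eq)
  have SQ_nth: "SQ ! k \<in> topspace Q" if "k < n" for k using SQ that by (auto simp: n_def)
  have SI_nth: "SI ! l \<in> topspace I" if "l < m" for l using SI that by (auto simp: m_def)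

  have "compactin euclideanreal ((\<lambda>(i, q). R i q) ` topspace (prod_topology I Q))"
    using assms(1,2) image_compactin[OF _ assms(3)]
    by (metis compact_space_def compact_space_prod_topology)
  then obtain M where M: "\<And>i q. i \<in> topspace I \<Longrightarrow> q \<in> topspace Q \<Longrightarrow> \<bar>R i q\<bar> \<le> M" and "M \<ge> 0"
    by (force simp: bounded_pos dest!: compact_imp_bounded)
  \<comment> \<open>Chosen so that the bound of \<open>dot_perturb\<close> in dimension
    \<open>n\<close> is at most \<epsilon>/4; the cap 1 is a premise of that lemma.\<close>
  define \<delta> where "\<delta> = min 1 (\<epsilon> / (4 * (real n * (M + 2))))"
  have \<delta>: "\<delta> > 0" "\<delta> \<le> 1"
    using \<open>\<epsilon> > 0\<close> \<open>M \<ge> 0\<close> \<open>n \<ge> 1\<close> by (auto simp: \<delta>_def)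

  \<comment> \<open>A product of tent functions: positive exactly when each of the first
    \<open>m\<close> coordinates of \<open>y\<close> is within 3\<eta> of the relevance vector of
    the \<open>k\<close>-th support query. It depends on \<open>y\<close> alone, so a network can
    approximate it.\<close>
  define w where "w y k = (\<Prod>l<m. max 0 (3 * \<eta> - \<bar>y l - R (SI ! l) (SQ ! k)\<bar>))" for y :: vec and k
  define g :: "vec \<Rightarrow> vec" where "g y k = (if k < n then w y k / sum (w y) {..<n} else 0)" for y k
  let ?qr = "query_relevance R SI"
  let ?ir = "item_relevance R SQ"
  define KQ where "KQ = ?qr ` topspace Q"
  define KI where "KI = ?ir ` topspace I"
  have qr: "?qr q l = R (SI ! l) q" if "l < m" for q l
    using that by (simp add: query_relevance_def m_def)
  have ir: "?ir i k = R i (SQ ! k)" if "k < n" for i k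
    using that by (simp add: item_relevance_def n_def)
  have w_nonneg: "w y k \<ge> 0" for y k
    unfolding w_def by (intro prod_nonneg) auto
  have w_sum_pos: "sum (w (?qr q)) {..<n} > 0" if q: "q \<in> topspace Q" for q
  proof -
    obtain k where k: "k < n" "\<And>i. i \<in> topspace I \<Longrightarrow> \<bar>R i q - R i (SQ ! k)\<bar> < \<eta>"
      using netQ[OF q] by (auto simp: in_set_conv_nth n_def)
    \<comment> \<open>The representative of \<open>q\<close> matches it up to \<eta> on every
      support item, so each factor exceeds 2\<eta>.\<close>
    have "w (?qr q) k > 0"
      unfolding w_def using k(2)[OF SI_nth] \<open>\<eta> > 0\<close> by (intro prod_pos) (fastforce simp: qr)
    then show ?thesis
      using k(1) w_nonneg by (intro sum_pos2[of _ k]) auto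
  qed
  have w_close: "\<bar>R i q - R i (SQ ! k)\<bar> \<le> 5 * \<eta>"
    if i: "i \<in> topspace I" and q: "q \<in> topspace Q" and k: "k < n" "w (?qr q) k \<noteq> 0" for i q k
  proof -
    obtain l where l: "l < m" "\<And>q. q \<in> topspace Q \<Longrightarrow> \<bar>R i q - R (SI ! l) q\<bar> < \<eta>"
      using netI[OF i] by (auto simp: in_set_conv_nth m_def)
    \<comment> \<open>A nonzero weight forces agreement within 3\<eta> at the representative of
      \<open>i\<close>. Passing from \<open>i\<close> to it costs \<eta> at \<open>q\<close> and
      again at \<open>SQ ! k\<close>, hence 5\<eta>.\<close>
    have "max 0 (3 * \<eta> - \<bar>R (SI ! l) q - R (SI ! l) (SQ ! k)\<bar>) \<noteq> 0"
      using k(2) l(1) by (auto simp: w_def qr)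
    then show ?thesis
      using l(2)[OF q] l(2)[OF SQ_nth[OF k(1)]] by linarith
  qed

  have "continuous_map (Euclidean_space m) euclideanreal (\<lambda>y. y l)" for l
    unfolding Euclidean_space_def by (intro continuous_map_from_subtopology continuous_map_product_projection) simp
  then have w_cont: "continuous_map (subtopology (Euclidean_space m) KQ) euclideanreal (\<lambda>y. w y k)" for k
    unfolding w_def
    by (intro continuous_map_from_subtopology continuous_map_prod continuous_map_real_max
        continuous_map_diff continuous_map_real_abs) auto
  \<comment> \<open>The restriction to \<open>KQ\<close> matters: there the denominator is positive
    by \<open>w_sum_pos\<close>.\<close>
  have "continuous_map (subtopology (Euclidean_space m) KQ) (Euclidean_space n) g"
    unfolding g_def continuous_map_componentwise_Euclidean_space
  proof (intro allI impI continuous_map_real_divide continuous_map_sum w_cont)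
    fix y assume "y \<in> topspace (subtopology (Euclidean_space m) KQ)"
    then show "sum (w y) {..<n} \<noteq> 0"
      using w_sum_pos by (force simp: KQ_def)
  qed auto
  moreover have "compactin (Euclidean_space m) KQ"
    using compactin_item_relevance[OF assms(2) swap SI(2)]
    by (simp add: KQ_def m_def query_relevance_eq)
  ultimately obtain \<theta>\<^sub>Q where \<theta>\<^sub>Q: "\<theta>\<^sub>Q \<in> \<Theta>\<^sub>Q m n"
    "\<And>y k. y \<in> KQ \<Longrightarrow> k < n \<Longrightarrow> \<bar>f\<^sub>Q m n y \<theta>\<^sub>Q k - g y k\<bar> < \<delta>"
    using universal_approximation_pointwise[OF assms(7) \<open>m \<ge> 1\<close> \<open>n \<ge> 1\<close> \<delta>(1)] by blast
  have "compactin (Euclidean_space n) KI"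
    using compactin_item_relevance[OF assms(1,3) SQ(2)] by (simp add: KI_def n_def)
  \<comment> \<open>The target for \<open>f\<^sub>I\<close> is the identity, so the embedding
    dimension is the number \<open>n\<close> of support queries.\<close>
  moreover have "continuous_map (subtopology (Euclidean_space n) KI) (Euclidean_space n) (\<lambda>x. x)"
    by (intro continuous_map_from_subtopology continuous_map_id[unfolded id_def])
  ultimately obtain \<theta>\<^sub>I where \<theta>\<^sub>I: "\<theta>\<^sub>I \<in> \<Theta>\<^sub>I n n"
    "\<And>x k. x \<in> KI \<Longrightarrow> k < n \<Longrightarrow> \<bar>f\<^sub>I n n x \<theta>\<^sub>I k - x k\<bar> < \<delta>"
    using universal_approximation_pointwise[OF assms(5) \<open>n \<ge> 1\<close> \<open>n \<ge> 1\<close> \<delta>(1)] by blast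

  have "\<bar>R i q - dot n (item_embedding R f\<^sub>I n SQ \<theta>\<^sub>I i) (query_embedding R f\<^sub>Q n SI \<theta>\<^sub>Q q)\<bar> < \<epsilon>"
    if i: "i \<in> topspace I" and q: "q \<in> topspace Q" for i q
  proof -
    let ?a = "item_embedding R f\<^sub>I n SQ \<theta>\<^sub>I i" and ?b = "query_embedding R f\<^sub>Q n SI \<theta>\<^sub>Q q"
    \<comment> \<open>With exact targets in place of the networks, the inner product is a weighted
      average of the relevances of \<open>i\<close> to the support queries.\<close>
    have "dot n (?ir i) (g (?qr q)) =
      (\<Sum>k<n. R i (SQ ! k) * (w (?qr q) k / sum (w (?qr q)) {..<n}))"
      by (simp add: dot_def g_def ir)
    then have 1: "\<bar>R i q - dot n (?ir i) (g (?qr q))\<bar> \<le> 5 * \<eta>"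
      using abs_weighted_average_diff_le[of "{..<n}" "w (?qr q)" "R i q" "\<lambda>k. R i (SQ ! k)" "5 * \<eta>"]
        w_nonneg w_sum_pos[OF q] w_close[OF i q] by auto
    have "\<bar>g (?qr q) k\<bar> \<le> 1" for k
      using w_nonneg w_sum_pos[OF q] member_le_sum[of k "{..<n}" "w (?qr q)"]
      by (simp add: g_def divide_le_eq)
    moreover have "\<bar>?ir i k\<bar> \<le> M" if "k < n" for k
      using M[OF i SQ_nth[OF that]] that by (simp add: ir)
    ultimately have "\<bar>dot n (?ir i) (g (?qr q)) - dot n ?a ?b\<bar> \<le> real n * ((M + 2) * \<delta>)"
      using \<theta>\<^sub>I(2)[of "?ir i"] \<theta>\<^sub>Q(2)[of "?qr q"] \<delta> \<open>M \<ge> 0\<close> i q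
      by (intro dot_perturb)
        (auto simp: item_embedding_def query_embedding_def KI_def KQ_def m_def n_def)
    also have "real n * ((M + 2) * \<delta>) \<le> \<epsilon> / 4"
    proof -
      have "real n * (M + 2) > 0" using \<open>n \<ge> 1\<close> \<open>M \<ge> 0\<close> by simp
      moreover have "\<delta> \<le> \<epsilon> / (4 * (real n * (M + 2)))" by (simp add: \<delta>_def)
      ultimately show ?thesis by (simp add: field_simps)
    qed
    finally show ?thesis
      using 1 \<open>\<epsilon> > 0\<close> unfolding \<eta>_def by linarith
  qed
  then show ?thesis
    using SI SQ \<theta>\<^sub>I(1) \<theta>\<^sub>Q(1) \<open>n \<ge> 1\<close> unfolding m_def n_def by blast
qed

end
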